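(* Let $p$ be an odd prime with $p\equiv 3 \pmod 4$, $n$ an odd positive integer, $q=p^n$, $N=\frac{p^n-1}{2}$, $\alpha$ a primitive element of $\mathbb{F}_q$, $\beta\in\mathbb{F}_q^*$, and $m(t)={\rm Tr}_1^n(\beta\alpha^t)$. Let $d=4$ or $d=N+1$, and let $$S=\{\,m(2t+i)+m(d(t+l)+j)\;:\;0\le i,j\le 1,\ 0\le l\le N-1\,\}.$$ Then the family size of $S$ is $4N$.
   Context: Here ${\rm Tr}_1^n(x)=\sum_{k=0}^{n-1}x^{p^k}$ is the trace function from $\mathbb{F}_q$ to $\mathbb{F}_p$. The sequence $m(t)$ is a $p$-ary m-sequence of period $q-1$; an element of $S$ is a $p$-ary sequence indexed by $t$ (for fixed $i,j,l$), with $s(t+N)=s(t)$ for all $t$. Two sequences $s_1,s_2$ of period $N$ are cyclically equivalent if there is $\tau$ with $s_1(t)=s_2(t+\tau)$ for all $t$. The family size of $S$ is the number of pairwise cyclically inequivalent sequences in $S$; thus the claim says that the $4N$ sequences given by the $4N$ parameter triples $(i,j,l)$ are pairwise cyclically inequivalent.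
   Formalization: The case p = 3, n = 1 is excluded, because the claim is false there: N = 1 and, for both values of d, the triples (i,j,l) = (0,1,0) and (1,0,0) both give the zero sequence, so the family size is 3 rather than 4. *)

theory Defs
  imports "HOL-Computational_Algebra.Primes" "HOL-Library.Cardinality"
begin

definition primitive_element :: "'a::{field,finite} \<Rightarrow> bool" where
  "primitive_element \<alpha> \<longleftrightarrow> range (\<lambda>k::nat. \<alpha> ^ k) = UNIV - {0}"

(* For CARD('a) = p ^ n this is the trace onto the prime field, which is regarded as a
   subfield of 'a. *)
definition field_trace :: "nat \<Rightarrow> nat \<Rightarrow> 'a::{field,finite} \<Rightarrow> 'a" where
  "field_trace p n x = (\<Sum>k<n. x ^ (p ^ k))"

definition m_seq :: "nat \<Rightarrow> nat \<Rightarrow> 'a::{field,finite} \<Rightarrow> 'a \<Rightarrow> nat \<Rightarrow> 'a" where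
  "m_seq p n \<alpha> \<beta> t = field_trace p n (\<beta> * \<alpha> ^ t)"

definition seq_family :: "(nat \<Rightarrow> 'a::plus) \<Rightarrow> nat \<Rightarrow> nat \<Rightarrow> (nat \<Rightarrow> 'a) set" where
  "seq_family m d N =
     {(\<lambda>t. m (2 * t + i) + m (d * (t + l) + j)) | i j l. i \<le> 1 \<and> j \<le> 1 \<and> l \<le> N - 1}"

definition cyclically_equivalent :: "(nat \<Rightarrow> 'a) \<Rightarrow> (nat \<Rightarrow> 'a) \<Rightarrow> bool" where
  "cyclically_equivalent s1 s2 \<longleftrightarrow> (\<exists>\<tau>. \<forall>t. s1 t = s2 (t + \<tau>))"

definition cyclic_rel :: "(nat \<Rightarrow> 'a) set \<Rightarrow> ((nat \<Rightarrow> 'a) \<times> (nat \<Rightarrow> 'a)) set" where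
  "cyclic_rel S = {(s1, s2). s1 \<in> S \<and> s2 \<in> S \<and> cyclically_equivalent s1 s2}"

(* Sequences are indexed by nat, so symmetry of the shift relation relies on periodicity. *)
lemma equiv_cyclic_rel:
  assumes per: "\<And>s t. s \<in> S \<Longrightarrow> s (t + N) = s t" and N: "N > 0"
  shows "equiv S (cyclic_rel S)"
proof (rule equivI)
  show "refl_on S (cyclic_rel S)"
    by (auto simp: refl_on_def cyclic_rel_def cyclically_equivalent_def intro: exI[of _ 0])
  show "sym (cyclic_rel S)"
  proof (rule symI)
    fix s1 s2 assume "(s1, s2) \<in> cyclic_rel S"
    then obtain \<tau> where S: "s1 \<in> S" "s2 \<in> S" and \<tau>: "\<And>t. s1 t = s2 (t + \<tau>)"
      by (auto simp: cyclic_rel_def cyclically_equivalent_def)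
    have mult: "s2 (t + k * N) = s2 t" for t k
    proof (induction k)
      case (Suc k)
      then show ?case using per[OF S(2), of "t + k * N"] by (simp add: algebra_simps)
    qed simp
    have "s2 t = s1 (t + (N - 1) * \<tau>)" for t
    proof -
      have "t + (N - 1) * \<tau> + \<tau> = t + \<tau> * N"
        using N by (cases N) (auto simp: algebra_simps)
      then show ?thesis using \<tau>[of "t + (N - 1) * \<tau>"] mult[of t \<tau>] by metis
    qed
    with S show "(s2, s1) \<in> cyclic_rel S"
      by (auto simp: cyclic_rel_def cyclically_equivalent_def)
  qed
  show "trans (cyclic_rel S)"
  proof (rule transI)
    fix s1 s2 s3 assume "(s1, s2) \<in> cyclic_rel S" "(s2, s3) \<in> cyclic_rel S"
    then obtain \<tau> \<tau>' where "s1 \<in> S" "s3 \<in> S"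
      and "\<And>t. s1 t = s2 (t + \<tau>)" "\<And>t. s2 t = s3 (t + \<tau>')"
      by (auto simp: cyclic_rel_def cyclically_equivalent_def)
    then show "(s1, s3) \<in> cyclic_rel S"
      by (auto simp: cyclic_rel_def cyclically_equivalent_def add.assoc
            intro!: exI[of _ "\<tau> + \<tau>'"])
  qed
qed (auto simp: cyclic_rel_def)

(* The largest number of pairwise cyclically inequivalent members, i.e. the number of classes. *)
definition family_size :: "(nat \<Rightarrow> 'a) set \<Rightarrow> nat" where
  "family_size S = card (S // cyclic_rel S)"

end

theory Submission
  imports Defs "HOL-Number_Theory.Cong"
begin

text \<open>
  For \<open>x = \<alpha> ^ (2 * t)\<close> the number \<open>\<alpha> ^ (d * t)\<close> is \<open>x\<^sup>2\<close> if \<open>d = 4\<close>, and the square root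
  of \<open>x\<close> that is itself a square if \<open>d = N + 1\<close>. In both cases a sequence of the family has the form
  \<open>t \<mapsto> Tr (A * g ^ t) + Tr (B * g ^ (2 * t))\<close> with \<open>g\<close> of order \<open>N\<close>. Since \<open>g ^ t\<close> occurs in it
  only with the exponents \<open>p ^ k\<close> and \<open>2 * p ^ k\<close>, of which only \<open>p ^ 0\<close> is congruent to \<open>1\<close>
  modulo \<open>N\<close>, summing against \<open>g ^ (- t)\<close> over a period isolates \<open>N * A\<close>, and \<open>B\<close> is found
  likewise. So the sequence determines both coefficients, and a cyclic shift between two members
  amounts to two congruences modulo \<open>2 * N\<close>, which force equality of the parameters.
\<close>

section \<open>Size of the field and powers of a primitive element\<close>

lemma of_nat_CARD_eq_0: "of_nat CARD('a) = (0 :: 'a::{comm_ring_1,finite})"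
proof -
  \<comment> \<open>Translation by 1 permutes the ring, so the extra summands 1 must add up to
    zero.\<close>
  have "(\<Sum>x\<in>UNIV. x + 1) = (\<Sum>x\<in>UNIV. x :: 'a)"
    by (rule sum.reindex_bij_witness[of _ "\<lambda>x. x - 1" "\<lambda>x. x + 1"]) auto
  then show ?thesis by (simp add: sum.distrib)
qed

text \<open>An exponent m > 0 with \<open>\<alpha> ^ m = 1\<close> confines the powers to m values,
  so it cannot lie below the number of nonzero elements; the pigeonhole principle shows that this
  number itself is such an exponent.\<close>

lemma primitive_element_power_eq_1_iff:
  fixes \<alpha> :: "'a::{field,finite}"
  assumes "primitive_element \<alpha>"
  shows "\<alpha> ^ m = 1 \<longleftrightarrow> CARD('a) - 1 dvd m"
proof -
  define M where "M = CARD('a) - 1"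
  have range: "range (\<lambda>k::nat. \<alpha> ^ k) = UNIV - {0}"
    using assms by (simp add: primitive_element_def)
  have card: "card (range (\<lambda>k::nat. \<alpha> ^ k)) = M"
    by (simp add: range M_def card_Diff_singleton)
  have nz: "\<alpha> \<noteq> 0"
    using range by (metis DiffD2 insertI1 power_one_right rangeI)
  have reduce: "\<alpha> ^ k = \<alpha> ^ (k mod m)" if "\<alpha> ^ m = 1" for k m
  proof -
    have "\<alpha> ^ k = \<alpha> ^ (m * (k div m) + k mod m)" by simp
    also have "\<dots> = \<alpha> ^ (k mod m)" using that by (simp only: power_add power_mult) simp
    finally show ?thesis .
  qed
  have lower: "M \<le> m" if "\<alpha> ^ m = 1" "m > 0" for m
  proof -
    have "range (\<lambda>k. \<alpha> ^ k) \<subseteq> (\<lambda>k. \<alpha> ^ k) ` {..<m}"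
      using reduce[OF that(1)] that(2) by (metis (no_types, lifting) image_subsetI imageI lessThan_iff mod_less_divisor)
    then have "M \<le> card ((\<lambda>k. \<alpha> ^ k) ` {..<m})"
      using card by (metis card_mono finite_imageI finite_lessThan)
    also have "\<dots> \<le> m" using card_image_le[of "{..<m}" "\<lambda>k. \<alpha> ^ k"] by simp
    finally show ?thesis .
  qed
  \<comment> \<open>M + 1 exponents give at most M values, so two of them collide, and
    \<open>lower\<close> forces their difference to be exactly M.\<close>
  have "\<not> inj_on (\<lambda>k. \<alpha> ^ k) {..M}"
  proof
    assume "inj_on (\<lambda>k. \<alpha> ^ k) {..M}"
    then have "card ((\<lambda>k. \<alpha> ^ k) ` {..M}) = Suc M" by (simp add: card_image)
    moreover have "card ((\<lambda>k. \<alpha> ^ k) ` {..M}) \<le> M"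
      unfolding card[symmetric] by (rule card_mono) auto
    ultimately show False by simp
  qed
  then obtain a b where ab: "a < b" "b \<le> M" "\<alpha> ^ a = \<alpha> ^ b"
    by (auto simp: inj_on_def) (metis linorder_neqE_nat)
  have "\<alpha> ^ b = \<alpha> ^ a * \<alpha> ^ (b - a)" using ab by (metis le_add_diff_inverse less_imp_le power_add)
  with ab nz have "\<alpha> ^ (b - a) = 1" by simp
  moreover from lower[OF this] ab have "b - a = M" by simp
  ultimately have M: "\<alpha> ^ M = 1" "M > 0" using ab by auto
  show ?thesis
  proof
    assume "\<alpha> ^ m = 1"
    then have "\<alpha> ^ (m mod M) = 1" using reduce[OF M(1), of m] by simp
    with lower[OF this] M(2) show "CARD('a) - 1 dvd m"
      unfolding M_def[symmetric] by (metis bot_nat_0.not_eq_extremum leD mod_eq_0_iff_dvd mod_less_divisor)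
  next
    assume "CARD('a) - 1 dvd m"
    then show "\<alpha> ^ m = 1" unfolding M_def[symmetric] using M(1) by (auto simp: power_mult)
  qed
qed

lemma power_eq_iff_cong:
  fixes \<alpha> :: "'a::field"
  assumes "\<alpha> \<noteq> 0" and ord: "\<And>m. \<alpha> ^ m = 1 \<longleftrightarrow> M dvd m"
  shows "\<alpha> ^ a = \<alpha> ^ b \<longleftrightarrow> [a = b] (mod M)"
proof (induction a b rule: linorder_wlog)
  case (le a b)
  have "\<alpha> ^ b = \<alpha> ^ a * \<alpha> ^ (b - a)" using le by (simp add: power_add[symmetric])
  then have "\<alpha> ^ a = \<alpha> ^ b \<longleftrightarrow> \<alpha> ^ (b - a) = 1" using assms(1) by auto
  then show ?case using le ord by (simp only: cong_sym_eq[of a b] cong_altdef_nat)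
next
  case (sym a b)
  then show ?case by (metis cong_sym_eq)
qed

section \<open>Sums over a full period\<close>

lemma sum_powers_root_of_unity:
  fixes g :: "'a::field"
  assumes "\<And>m. g ^ m = 1 \<longleftrightarrow> N dvd m"
  shows "(\<Sum>t<N. g ^ (m * t)) = (if N dvd m then of_nat N else 0)"
proof (cases "N dvd m")
  case True
  then have "g ^ m = 1" using assms by simp
  with True show ?thesis by (simp add: power_mult)
next
  case False
  then have "g ^ m \<noteq> 1" using assms by simp
  moreover have "(g ^ m) ^ N = 1" using assms by (metis dvd_triv_right power_mult)
  ultimately show ?thesis
    using False geometric_sum[of "g ^ m" N] by (simp add: power_mult)
qed

text \<open>The weight \<open>g ^ ((N - 1) * t)\<close> stands for \<open>g ^ (- t)\<close>.\<close>

lemma sum_field_trace: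
  fixes g C :: "'a::{field,finite}"
  assumes "\<And>m. g ^ m = 1 \<longleftrightarrow> N dvd m"
  shows "(\<Sum>t<N. g ^ ((N - 1) * t) * field_trace p n (C * g ^ (e * t)))
       = (\<Sum>k<n. C ^ (p ^ k) * (if N dvd e * p ^ k + (N - 1) then of_nat N else 0))"
proof -
  have "(\<Sum>t<N. g ^ ((N - 1) * t) * field_trace p n (C * g ^ (e * t)))
      = (\<Sum>t<N. \<Sum>k<n. C ^ (p ^ k) * g ^ ((e * p ^ k + (N - 1)) * t))"
    unfolding field_trace_def sum_distrib_left
  proof (intro sum.cong refl)
    fix t k :: nat
    have "(C * g ^ (e * t)) ^ (p ^ k) = C ^ (p ^ k) * g ^ (e * t * p ^ k)"
      by (simp add: power_mult_distrib flip: power_mult)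
    also have "e * t * p ^ k = e * p ^ k * t" by simp
    finally have "(C * g ^ (e * t)) ^ (p ^ k) = C ^ (p ^ k) * g ^ (e * p ^ k * t)" .
    then show "g ^ ((N - 1) * t) * (C * g ^ (e * t)) ^ (p ^ k)
        = C ^ (p ^ k) * g ^ ((e * p ^ k + (N - 1)) * t)"
      by (simp add: distrib_right power_add)
  qed
  also have "\<dots> = (\<Sum>k<n. C ^ (p ^ k) * (\<Sum>t<N. g ^ ((e * p ^ k + (N - 1)) * t)))"
    by (subst sum.swap) (simp add: sum_distrib_left)
  finally show ?thesis by (simp only: sum_powers_root_of_unity[OF assms])
qed

section \<open>Recovering the coefficients from the sequence\<close>

context
  fixes p n N :: nat
  assumes p: "p \<ge> 3" and n: "n > 0" and N: "2 * N = p ^ n - 1" and excl: "p ^ n \<noteq> 3"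
begin

lemma power_bound:
  assumes "k < n"
  shows "3 * p ^ k \<le> p ^ n"
proof -
  have "3 * p ^ k \<le> p ^ Suc k" using mult_le_mono1[OF p, of "p ^ k"] by simp
  also have "\<dots> \<le> p ^ n" using assms p by (intro power_increasing) auto
  finally show ?thesis .
qed

lemma N_pos: "N > 0"
  using power_bound[OF n] N by simp

text \<open>Divisibility means that N divides \<open>p ^ k - 1\<close>, which is less than N by
  \<open>power_bound\<close>, hence zero.\<close>

lemma dvd_power_iff:
  assumes "k < n"
  shows "N dvd p ^ k + (N - 1) \<longleftrightarrow> k = 0"
proof
  assume "N dvd p ^ k + (N - 1)"
  moreover have "p ^ k \<ge> 1" using p by simp
  moreover have "p ^ k + (N - 1) = (p ^ k - 1) + N" using N_pos \<open>p ^ k \<ge> 1\<close> by simp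
  ultimately have "N dvd p ^ k - 1" by (metis dvd_add_left_iff dvd_refl)
  moreover have "p ^ k - 1 < N" using power_bound[OF assms] \<open>p ^ k \<ge> 1\<close> N by linarith
  ultimately have "p ^ k = 1" using \<open>p ^ k \<ge> 1\<close> by (auto dest: nat_dvd_not_less[rotated])
  then show "k = 0" using p by simp
qed (use N_pos in simp)

text \<open>The positive number \<open>2 * p ^ k - 1\<close> is below \<open>2 * N\<close>, so as a
  multiple of N it could only be N itself, that is, \<open>4 * p ^ k = p ^ n + 1\<close>. For k = 0
  this is the excluded \<open>p ^ n = 3\<close>; for k > 0 it makes p divide 1.\<close>

lemma not_dvd_double_power:
  assumes "k < n"
  shows "\<not> N dvd 2 * p ^ k + (N - 1)"
proof
  assume "N dvd 2 * p ^ k + (N - 1)"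
  moreover have ge1: "p ^ k \<ge> 1" using p by simp
  moreover have "2 * p ^ k + (N - 1) = (2 * p ^ k - 1) + N" using N_pos ge1 by simp
  ultimately have "N dvd 2 * p ^ k - 1" by (metis dvd_add_left_iff dvd_refl)
  then obtain c where c: "2 * p ^ k - 1 = N * c" ..
  have "2 * p ^ k - 1 < 2 * N" using power_bound[OF assms] ge1 N by linarith
  with c N_pos have "c < 2" by (simp add: mult.commute)
  with c ge1 have "c = 1" by (cases c) auto
  with c have eq: "4 * p ^ k = p ^ n + 1" using N ge1 by simp
  show False
  proof (cases k)
    case 0
    with eq excl show False by simp
  next
    case (Suc k')
    then have "p dvd 4 * p ^ k" "p dvd p ^ n" using n by auto
    with eq have "p dvd 1" by (metis dvd_add_right_iff)
    with p show False by simp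
  qed
qed

lemma trace_coeff_eq:
  fixes g A A' B B' :: "'a::{field,finite}"
  assumes ord: "\<And>m. g ^ m = 1 \<longleftrightarrow> N dvd m" and Nz: "of_nat N \<noteq> (0 :: 'a)"
    and eq: "\<And>t. field_trace p n (A * g ^ t) + field_trace p n (B * g ^ (2 * t))
                = field_trace p n (A' * g ^ t) + field_trace p n (B' * g ^ (2 * t))"
  shows "A = A'"
proof -
  \<comment> \<open>Only the term k = 0 of the first trace survives the summation.\<close>
  have val: "(\<Sum>t<N. g ^ ((N - 1) * t) *
        (field_trace p n (C * g ^ t) + field_trace p n (D * g ^ (2 * t)))) = C * of_nat N" for C D
  proof -
    have "(\<Sum>t<N. g ^ ((N - 1) * t) *
        (field_trace p n (C * g ^ t) + field_trace p n (D * g ^ (2 * t))))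
      = (\<Sum>k<n. C ^ (p ^ k) * (if N dvd p ^ k + (N - 1) then of_nat N else 0))
      + (\<Sum>k<n. D ^ (p ^ k) * (if N dvd 2 * p ^ k + (N - 1) then of_nat N else 0))"
      using sum_field_trace[OF ord, of p n C 1] sum_field_trace[OF ord, of p n D 2]
      by (simp add: distrib_left sum.distrib)
    also have "(\<Sum>k<n. C ^ (p ^ k) * (if N dvd p ^ k + (N - 1) then of_nat N else 0))
      = (\<Sum>k<n. if k = 0 then C * of_nat N else 0)"
      by (rule sum.cong) (simp_all only: dvd_power_iff lessThan_iff power_0 power_one_right if_distrib, auto)
    also have "\<dots> = C * of_nat N" using n by simp
    also have "(\<Sum>k<n. D ^ (p ^ k) * (if N dvd 2 * p ^ k + (N - 1) then of_nat N else 0)) = 0"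
      by (rule sum.neutral) (simp add: not_dvd_double_power[unfolded One_nat_def])
    finally show ?thesis by simp
  qed
  have "A * of_nat N = A' * of_nat N"
    unfolding val[of A B, symmetric] val[of A' B', symmetric] by (simp only: eq)
  then show ?thesis using Nz by simp
qed

lemma trace_coeffs_eq:
  fixes g A A' B B' :: "'a::{field,finite}"
  assumes ord: "\<And>m. g ^ m = 1 \<longleftrightarrow> N dvd m" and Nz: "of_nat N \<noteq> (0 :: 'a)" and "odd N"
    and eq: "\<And>t. field_trace p n (A * g ^ t) + field_trace p n (B * g ^ (2 * t))
                = field_trace p n (A' * g ^ t) + field_trace p n (B' * g ^ (2 * t))"
  shows "A = A' \<and> B = B'"
proof
  show A: "A = A'" by (rule trace_coeff_eq[OF ord Nz eq])
  have "coprime N 2" using \<open>odd N\<close> by simp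
  \<comment> \<open>As N is odd, \<open>g ^ 2\<close> also has order N. Once A = A' is cancelled, B
    becomes the leading coefficient with respect to \<open>g ^ 2\<close>, and a zero second
    coefficient restores the shape needed by \<open>trace_coeff_eq\<close>.\<close>
  then have ord2: "(g ^ 2) ^ m = 1 \<longleftrightarrow> N dvd m" for m
    by (simp add: ord coprime_dvd_mult_right_iff flip: power_mult)
  have "field_trace p n (B * (g ^ 2) ^ t) + field_trace p n (0 * (g ^ 2) ^ (2 * t))
      = field_trace p n (B' * (g ^ 2) ^ t) + field_trace p n (0 * (g ^ 2) ^ (2 * t))" for t
    using eq[of t] by (simp add: A flip: power_mult)
  then show "B = B'" by (rule trace_coeff_eq[OF ord2 Nz])
qed

end

section \<open>From congruences to parameters\<close>

lemma parameters_eq: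
  fixes N d i i' j j' l l' \<tau> :: nat
  assumes "even d" "coprime N d" "odd N"
    and bounds: "i \<le> 1" "i' \<le> 1" "j \<le> 1" "j' \<le> 1" "l < N" "l' < N"
    and i: "[i = 2 * \<tau> + i'] (mod 2 * N)" and j: "[d * l + j = d * (l' + \<tau>) + j'] (mod 2 * N)"
  shows "i = i' \<and> j = j' \<and> l = l'"
proof -
  \<comment> \<open>Modulo 2 the shift disappears, since 2 and d are even.\<close>
  have "[i = 2 * \<tau> + i'] (mod 2)" using i by (rule cong_modulus_mult_nat)
  then have ii: "i = i'" using bounds by (auto simp: cong_def le_Suc_eq)
  have "[d * l + j = d * (l' + \<tau>) + j'] (mod 2)" using j by (rule cong_modulus_mult_nat)
  then have jj: "j = j'"
    using \<open>even d\<close> bounds by (auto simp: cong_def le_Suc_eq mod_add_eq[symmetric] elim!: evenE)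
  have iN: "[i = 2 * \<tau> + i'] (mod N)" and jN: "[d * l + j = d * (l' + \<tau>) + j'] (mod N)"
    using i j by (metis cong_modulus_mult_nat mult.commute)+
  \<comment> \<open>Modulo N both 2 and d can be cancelled: first the shift vanishes, then l and l'
    agree.\<close>
  have "[2 * \<tau> = 2 * 0] (mod N)"
    using iN unfolding ii by (metis add.left_neutral cong_add_rcancel_nat cong_sym mult_0_right)
  then have \<tau>: "[\<tau> = 0] (mod N)"
    using \<open>odd N\<close> by (subst (asm) cong_mult_lcancel_nat) auto
  have "[d * l = d * (l' + \<tau>)] (mod N)"
    using jN unfolding jj by (simp only: cong_add_rcancel_nat)
  then have "[l = l' + \<tau>] (mod N)"
    using \<open>coprime N d\<close> by (subst (asm) cong_mult_lcancel_nat) (auto simp: coprime_commute)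
  also have "[l' + \<tau> = l' + 0] (mod N)" using \<tau> by (intro cong_add cong_refl)
  finally have "l = l'" using bounds by (auto simp: cong_less_modulus_unique_nat)
  with ii jj show ?thesis by simp
qed

section \<open>Counting the family\<close>

lemma cyclically_equivalent_refl: "cyclically_equivalent s s"
  by (auto simp: cyclically_equivalent_def intro: exI[of _ 0])

lemma family_size_eq_card:
  assumes "\<And>s1 s2. s1 \<in> S \<Longrightarrow> s2 \<in> S \<Longrightarrow> cyclically_equivalent s1 s2 \<Longrightarrow> s1 = s2"
  shows "family_size S = card S"
proof -
  have "cyclic_rel S = Id_on S"
    using assms by (auto simp: cyclic_rel_def cyclically_equivalent_refl)
  then have "S // cyclic_rel S = (\<lambda>s. {s}) ` S"
    by (auto simp: quotient_def Id_on_def)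
  then show ?thesis by (simp add: family_size_def card_image)
qed

(* The case p = 3, n = 1 is excluded because the claim fails there: N = 1, and for both values
   of d the parameters (i,j,l) = (0,1,0) and (1,0,0) give the zero sequence. *)
theorem theorem8:
  fixes \<alpha> \<beta> :: "'a::{field,finite}" and p n q N d :: nat
  assumes "prime p" and "odd p" and "p mod 4 = 3"
    and "n > 0" and "odd n"
    and "q = p ^ n" and "CARD('a) = q"
    and "N = (p ^ n - 1) div 2"
    and "primitive_element \<alpha>" and "\<beta> \<noteq> 0"
    and "d = 4 \<or> d = N + 1"
    and "\<not> (p = 3 \<and> n = 1)"
  shows "family_size (seq_family (m_seq p n \<alpha> \<beta>) d N) = 4 * N"
proof -
  have p3: "p \<ge> 3" using assms(3) by (metis mod_less_eq_dividend)
  \<comment> \<open>As n is odd, \<open>p ^ n\<close> is 3 modulo 4 like p, and this makes N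
    odd.\<close>
  have "p ^ n mod 4 = 3 ^ n mod 4" using assms(3) by (metis power_mod)
  also have "3 ^ n mod 4 = (3 :: nat)"
  proof -
    obtain k where "n = 2 * k + 1" using \<open>odd n\<close> by (elim oddE)
    then have "3 ^ n mod 4 = 3 * (9 ^ k mod 4) mod (4 :: nat)"
      by (simp add: power_mult mod_mult_right_eq)
    also have "9 ^ k mod 4 = (1 :: nat)" using power_mod[of "9::nat" 4 k] by simp
    finally show ?thesis by simp
  qed
  finally have mod4: "p ^ n mod 4 = 3" .
  have N2: "2 * N = p ^ n - 1" and "odd N"
    using mod4 unfolding assms(8) by presburger+
  have excl: "p ^ n \<noteq> 3"
  proof
    assume "p ^ n = 3"
    moreover have "p ^ 1 \<le> p ^ n" using p3 \<open>n > 0\<close> by (intro power_increasing) auto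
    ultimately have "p = 3" using p3 by simp
    with \<open>p ^ n = 3\<close> have "(3::nat) ^ n = 3 ^ 1" by simp
    then have "n = 1" by (subst (asm) power_inject_exp) auto
    with \<open>p = 3\<close> assms(12) show False by simp
  qed
  note ctxt = p3 \<open>n > 0\<close> N2 excl
  have Npos: "N > 0" by (rule N_pos[OF ctxt])

  have card: "CARD('a) = 2 * N + 1" using assms(6,7) N2 p3 by simp
  have Nz: "of_nat N \<noteq> (0 :: 'a)"
  proof
    assume "of_nat N = (0 :: 'a)"
    then have "of_nat CARD('a) = (1 :: 'a)" unfolding card by simp
    then show False by (simp add: of_nat_CARD_eq_0)
  qed
  have ord: "\<alpha> ^ m = 1 \<longleftrightarrow> 2 * N dvd m" for m
    using primitive_element_power_eq_1_iff[OF assms(9)] card by simp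
  have \<alpha>: "\<alpha> \<noteq> 0" using ord[of "2 * N"] Npos by (auto simp: power_0_left)
  note \<alpha>_cong = power_eq_iff_cong[OF \<alpha> ord]

  have "even d" using assms(11) \<open>odd N\<close> by auto
  have "coprime N 2" using \<open>odd N\<close> by simp
  \<comment> \<open>This serves d = 4; for d = N + 1 the two numbers are consecutive.\<close>
  then have "coprime N (2 * 2)" using coprime_mult_right_iff by blast
  then have "coprime N d" using assms(11) by auto

  have coeffs: "A = A' \<and> B = B'"
    if eq: "\<And>t. field_trace p n (A * \<alpha> ^ (2 * t)) + field_trace p n (B * \<alpha> ^ (d * t))
        = field_trace p n (A' * \<alpha> ^ (2 * t)) + field_trace p n (B' * \<alpha> ^ (d * t))"
    for A B A' B'
    using assms(11)
  proof
    assume d: "d = 4"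
    have "(\<alpha> ^ 2) ^ m = 1 \<longleftrightarrow> N dvd m" for m by (simp add: ord flip: power_mult)
    \<comment> \<open>Here g is \<open>\<alpha> ^ 2\<close>, and \<open>\<alpha> ^ (4 * t)\<close>
      is \<open>g ^ (2 * t)\<close>.\<close>
    from trace_coeffs_eq[OF ctxt this Nz \<open>odd N\<close>, of A B A' B'] eq show ?thesis
      by (simp add: d flip: power_mult)
  next
    \<comment> \<open>Here g is \<open>\<alpha> ^ d\<close>. Since 2 * d = 2 * N + 2, the power
      \<open>g ^ (2 * t)\<close> is \<open>\<alpha> ^ (2 * t)\<close>, so A and B exchange their
      roles.\<close>
    assume d: "d = N + 1"
    obtain e where e: "d = 2 * e" using \<open>even d\<close> by (elim evenE)
    have "coprime N e" using \<open>coprime N d\<close> unfolding e by simp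
    then have "(\<alpha> ^ d) ^ m = 1 \<longleftrightarrow> N dvd m" for m
      by (simp add: ord e coprime_dvd_mult_right_iff mult.assoc flip: power_mult)
    moreover have "(\<alpha> ^ d) ^ (2 * t) = \<alpha> ^ (2 * t)" for t
    proof -
      have "d * (2 * t) = 2 * t + 2 * N * t" by (simp add: d algebra_simps)
      then show ?thesis unfolding power_mult[symmetric] \<alpha>_cong by (simp only: cong_def mod_mult_self2)
    qed
    ultimately show ?thesis
      using trace_coeffs_eq[OF ctxt _ Nz \<open>odd N\<close>, of "\<alpha> ^ d" B A B' A'] eq
      by (simp add: power_mult add.commute)
  qed

  define s where
    "s = (\<lambda>(i, j, l) t. m_seq p n \<alpha> \<beta> (2 * t + i) + m_seq p n \<alpha> \<beta> (d * (t + l) + j))"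
  define P where "P = {..1::nat} \<times> {..1::nat} \<times> {..N - 1}"
  have family: "seq_family (m_seq p n \<alpha> \<beta>) d N = s ` P"
    unfolding seq_family_def s_def P_def by (auto simp: image_iff) blast+
  have params: "x = y" if xP: "x \<in> P" and yP: "y \<in> P" and cyc: "cyclically_equivalent (s x) (s y)" for x y
  proof -
    obtain i j l i' j' l' where xy: "x = (i, j, l)" "y = (i', j', l')" by (metis prod_cases3)
    obtain \<tau> where \<tau>: "\<And>t. s x t = s y (t + \<tau>)"
      using cyc by (auto simp: cyclically_equivalent_def)
    \<comment> \<open>A shift by \<open>\<tau>\<close> only multiplies the two coefficients of
      \<open>s y\<close> by \<open>\<alpha> ^ (2 * \<tau>)\<close> and
      \<open>\<alpha> ^ (d * \<tau>)\<close>.\<close>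
    have "\<beta> * \<alpha> ^ i = \<beta> * \<alpha> ^ (2 * \<tau> + i') \<and>
          \<beta> * \<alpha> ^ (d * l + j) = \<beta> * \<alpha> ^ (d * (l' + \<tau>) + j')"
    proof (rule coeffs)
      fix t
      show "field_trace p n (\<beta> * \<alpha> ^ i * \<alpha> ^ (2 * t))
          + field_trace p n (\<beta> * \<alpha> ^ (d * l + j) * \<alpha> ^ (d * t))
          = field_trace p n (\<beta> * \<alpha> ^ (2 * \<tau> + i') * \<alpha> ^ (2 * t))
          + field_trace p n (\<beta> * \<alpha> ^ (d * (l' + \<tau>) + j') * \<alpha> ^ (d * t))"
        using \<tau>[of t] by (simp add: s_def xy m_seq_def algebra_simps power_add)
    qed
    then have "[i = 2 * \<tau> + i'] (mod 2 * N)" "[d * l + j = d * (l' + \<tau>) + j'] (mod 2 * N)"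
      using \<open>\<beta> \<noteq> 0\<close> by (simp_all add: \<alpha>_cong)
    moreover have "i \<le> 1" "i' \<le> 1" "j \<le> 1" "j' \<le> 1" "l < N" "l' < N"
      using xP yP Npos by (auto simp: xy P_def)
    ultimately show ?thesis
      using parameters_eq[OF \<open>even d\<close> \<open>coprime N d\<close> \<open>odd N\<close>] by (simp add: xy)
  qed
  \<comment> \<open>Equal sequences are equivalent by the zero shift, so \<open>params\<close> also
    shows that distinct triples give distinct sequences.\<close>
  have "inj_on s P"
    by (rule inj_onI) (metis params cyclically_equivalent_refl)
  then have "card (s ` P) = 4 * N" using Npos by (simp add: card_image P_def)
  moreover have "family_size (s ` P) = card (s ` P)"
    by (rule family_size_eq_card) (use params in blast)
  ultimately show ?thesis by (simp add: family)
qed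

end
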